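(* Let $K,L\subseteq\mathbb{R}^n$ be convex bodies with $0\in K\cap L$. For every $\theta\in[0,1]$, \[ \mathrm{Vol}(L\vee(-K))\,\mathrm{Vol}\big(\theta K\cap(1-\theta)L\big)\le \mathrm{Vol}(K)\,\mathrm{Vol}(L). \]
   Context: A convex body is a compact convex subset of $\mathbb{R}^n$ with non-empty interior. For sets $A,B$, $A\vee B$ denotes the convex hull of $A\cup B$. *)

theory Defs
  imports "HOL-Analysis.Analysis"
begin

definition convex_body :: "'a::euclidean_space set \<Rightarrow> bool" where
  "convex_body K \<longleftrightarrow> compact K \<and> convex K \<and> interior K \<noteq> {}"

end

theory Submission
  imports Defs "HOL-Probability.Distributions"
begin

text \<open>
  Let \<open>g\<^sub>K\<close> be the gauge of \<open>K\<close>, let \<open>D = L \<or> (-K)\<close> and \<open>M = \<theta>K \<inter> (1-\<theta>)L\<close>.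
  Since \<open>exp (-g\<^sub>K)\<close> has integral \<open>n! Vol K\<close>, the double integral of
  \<open>exp (-g\<^sub>K x) exp (-g\<^sub>L (z + x))\<close> over \<open>x\<close> and \<open>z\<close> is \<open>n!\<^sup>2 Vol K Vol L\<close>.
  For fixed \<open>z\<close> write \<open>z = b - a\<close> with \<open>g\<^sub>K a + g\<^sub>L b = g\<^sub>D z\<close>. Substituting \<open>x = a + w\<close>,
  the triangle inequality and \<open>g\<^sub>K w + g\<^sub>L w \<le> g\<^sub>M w\<close> bound the integrand from below by
  \<open>exp (-g\<^sub>D z) exp (-g\<^sub>M w)\<close>, whose double integral is \<open>n!\<^sup>2 Vol D Vol M\<close>.
\<close>

text \<open>
  For compact convex \<open>K\<close> containing 0 this is \<open>exp (-g\<^sub>K x)\<close>, with value 0 where the gauge is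
  infinite (0 may lie on the boundary of \<open>K\<close>). In integral form, measurability and the
  integral over \<open>x\<close> come directly from Tonelli's theorem.
\<close>

definition exp_gauge :: "'a::euclidean_space set \<Rightarrow> 'a \<Rightarrow> ennreal" where
  "exp_gauge K x = (\<integral>\<^sup>+s. ennreal (exp (- s)) * indicator {s. 0 < s \<and> x /\<^sub>R s \<in> K} s \<partial>lborel)"

section \<open>Exponential tails and pointwise bounds for \<open>exp_gauge\<close>\<close>

lemma nn_integral_exp_atLeast:
  "(\<integral>\<^sup>+s. ennreal (exp (- s)) * indicator {g..} s \<partial>lborel) = ennreal (exp (- g))"
proof -
  have "(\<integral>\<^sup>+s. ennreal (exp (- s)) * indicator {g..} s \<partial>lborel) = ennreal (0 - (- exp (- g)))"
  proof (rule nn_integral_FTC_atLeast)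
    show "((\<lambda>x::real. - exp (- x)) \<longlongrightarrow> 0) at_top"
      by (rule tendsto_eq_intros filterlim_compose[OF exp_at_bot] filterlim_uminus_at_bot_at_top)+ simp
    show "((\<lambda>x. - exp (- x)) has_real_derivative exp (- x)) (at x)" for x :: real
      by (rule derivative_eq_intros refl)+ simp
  qed auto
  then show ?thesis by simp
qed

text \<open>The closed tail serves upper bounds on \<open>exp_gauge\<close>. The open one serves
  lower bounds, since it stays inside the positive scales even for \<open>g = 0\<close>.\<close>

lemma nn_integral_exp_greaterThan:
  "(\<integral>\<^sup>+s. ennreal (exp (- s)) * indicator {g<..} s \<partial>lborel) = ennreal (exp (- g))"
proof -
  have "(\<integral>\<^sup>+s. ennreal (exp (- s)) * indicator {g<..} s \<partial>lborel)
      = (\<integral>\<^sup>+s. ennreal (exp (- s)) * indicator {g..} s \<partial>lborel)"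
    by (rule nn_integral_cong_AE, rule AE_mp[OF AE_lborel_singleton[of g]])
       (auto split: split_indicator)
  then show ?thesis by (simp only: nn_integral_exp_atLeast)
qed

text \<open>Convexity and \<open>0 \<in> K\<close> make the admissible scales upward closed, so the
  whole tail beyond \<open>s\<close> contributes. Membership in the image \<open>s K\<close>, unlike
  \<open>x /\<^sub>R s \<in> K\<close>, also treats \<open>s = 0\<close> correctly.\<close>

lemma exp_gauge_ge:
  assumes "convex K" "0 \<in> K" "0 \<le> s" "x \<in> (\<lambda>y. s *\<^sub>R y) ` K"
  shows "ennreal (exp (- s)) \<le> exp_gauge K x"
proof -
  obtain y where y: "y \<in> K" "x = s *\<^sub>R y" using assms(4) by auto
  have "x /\<^sub>R t \<in> K" if "s < t" for t
  proof -
    have "(s / t) *\<^sub>R y + (1 - s / t) *\<^sub>R 0 \<in> K"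
      using that assms y(1) by (intro convexD) (auto simp: field_simps)
    then show ?thesis using y(2) by (simp add: divide_inverse mult.commute)
  qed
  then have "(\<integral>\<^sup>+t. ennreal (exp (- t)) * indicator {s<..} t \<partial>lborel) \<le> exp_gauge K x"
    unfolding exp_gauge_def
    using assms(3) by (intro nn_integral_mono) (auto split: split_indicator)
  then show ?thesis by (simp only: nn_integral_exp_greaterThan)
qed

text \<open>A nonzero value provides one admissible scale; compactness then yields a least one, the
  gauge of \<open>x\<close>, and every contributing scale lies in the tail from there.\<close>

lemma exp_gauge_attained:
  fixes K :: "'a::euclidean_space set"
  assumes "compact K" "exp_gauge K x \<noteq> 0"
  obtains s where "0 \<le> s" "x \<in> (\<lambda>y. s *\<^sub>R y) ` K" "exp_gauge K x \<le> ennreal (exp (- s))"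
proof -
  \<comment> \<open>Cutting off at \<open>b\<close> makes the set of pairs bounded, and the equation
    \<open>s y = x\<close> keeps it closed at \<open>s = 0\<close>. Hence \<open>T b\<close> is a
    projection of a compact set.\<close>
  define T where "T b = fst ` {p \<in> {0..b::real} \<times> K. fst p *\<^sub>R snd p = x}" for b
  have mem: "s \<in> T b" if "0 < s" "s \<le> b" "x /\<^sub>R s \<in> K" for s b
  proof -
    have "(s, x /\<^sub>R s) \<in> {p \<in> {0..b} \<times> K. fst p *\<^sub>R snd p = x}" using that by simp
    then show ?thesis unfolding T_def by (metis (no_types, lifting) fst_conv image_eqI)
  qed
  have "\<exists>b>0. x /\<^sub>R b \<in> K"
  proof (rule ccontr)
    assume "\<not> ?thesis"
    then have "{s. 0 < s \<and> x /\<^sub>R s \<in> K} = {}" by blast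
    then have "exp_gauge K x = 0"
      unfolding exp_gauge_def by simp
    with assms(2) show False by contradiction
  qed
  then obtain b where b: "b > 0" "x /\<^sub>R b \<in> K" by auto
  have "compact ({p \<in> {0..b::real} \<times> K. fst p *\<^sub>R snd p = x})"
  proof -
    have "closed ((\<lambda>p::real \<times> 'a. fst p *\<^sub>R snd p) -` {x})"
      by (rule closed_vimage[OF closed_singleton])
         (rule continuous_on_scaleR[OF continuous_on_fst[OF continuous_on_id] continuous_on_snd[OF continuous_on_id]])
    then have "compact (({0..b} \<times> K) \<inter> (\<lambda>p. fst p *\<^sub>R snd p) -` {x})"
      using assms(1) by (intro compact_Int_closed compact_Times compact_Icc)
    also have "({0..b} \<times> K) \<inter> (\<lambda>p. fst p *\<^sub>R snd p) -` {x}
        = {p \<in> {0..b::real} \<times> K. fst p *\<^sub>R snd p = x}" by auto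
    finally show ?thesis .
  qed
  then have "compact (T b)" unfolding T_def
    by (rule compact_continuous_image[OF continuous_on_fst[OF continuous_on_id]])
  moreover have "T b \<noteq> {}" using mem[of b b] b by auto
  ultimately obtain s where s: "s \<in> T b" "\<And>t. t \<in> T b \<Longrightarrow> s \<le> t"
    using compact_attains_inf[of "T b"] by auto
  \<comment> \<open>Minimality within \<open>T b\<close> suffices: scales beyond \<open>b\<close>
    exceed \<open>s\<close> because \<open>s \<le> b\<close>.\<close>
  have le: "s \<le> t" if "0 < t" "x /\<^sub>R t \<in> K" for t
    using that mem[of t b] s by (cases "t \<le> b") (auto simp: T_def)
  have "exp_gauge K x \<le> (\<integral>\<^sup>+t. ennreal (exp (- t)) * indicator {s..} t \<partial>lborel)"
    unfolding exp_gauge_def using le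
    by (intro nn_integral_mono) (auto split: split_indicator)
  also have "\<dots> = ennreal (exp (- s))" by (rule nn_integral_exp_atLeast)
  finally have "exp_gauge K x \<le> ennreal (exp (- s))" .
  with s(1) show ?thesis by (intro that[of s]) (auto simp: T_def)
qed

section \<open>Measurability and total integral of \<open>exp_gauge\<close>\<close>

lemma borel_measurable_exp_gauge_integrand:
  fixes K :: "'a::euclidean_space set"
  assumes "compact K"
  shows "(\<lambda>(x, s). ennreal (exp (- s)) * indicator {s. 0 < s \<and> x /\<^sub>R s \<in> K} s)
    \<in> borel_measurable (lborel \<Otimes>\<^sub>M lborel)"
proof -
  have [measurable]: "K \<in> sets borel" using assms by (simp add: borel_compact)
  have "(\<lambda>(x::'a, s). ennreal (exp (- s)) * indicator {s. 0 < s \<and> x /\<^sub>R s \<in> K} s)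
    = (\<lambda>p. ennreal (exp (- snd p)) * (indicator {0<..} (snd p) * indicator K (fst p /\<^sub>R snd p)))"
    by (auto simp: fun_eq_iff split: split_indicator)
  also have "\<dots> \<in> borel_measurable (lborel \<Otimes>\<^sub>M lborel)"
    by measurable
  finally show ?thesis .
qed

lemma borel_measurable_exp_gauge:
  "compact K \<Longrightarrow> exp_gauge K \<in> borel_measurable lborel"
  using lborel.borel_measurable_nn_integral[OF borel_measurable_exp_gauge_integrand]
  by (simp add: exp_gauge_def[abs_def])

lemma ennreal_fact: "ennreal (fact n) = fact n"
  by (metis ennreal_of_nat_eq_real_of_nat of_nat_fact)

text \<open>After Tonelli the slice at \<open>s > 0\<close> is \<open>s K\<close>, of volume
  \<open>s ^ n\<close> times that of \<open>K\<close>; the remaining integral of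
  \<open>s ^ n * exp (- s)\<close> is the Gamma integral \<open>n!\<close>.\<close>

lemma nn_integral_exp_gauge:
  fixes K :: "'a::euclidean_space set"
  assumes "compact K"
  shows "(\<integral>\<^sup>+x. exp_gauge K x \<partial>lborel) = fact DIM('a) * emeasure lborel K"
proof -
  have K: "K \<in> sets borel" using assms by (simp add: borel_compact)
  have "(\<integral>\<^sup>+x. exp_gauge K x \<partial>lborel) =
     (\<integral>\<^sup>+s. \<integral>\<^sup>+x. ennreal (exp (- s)) * indicator {s. 0 < s \<and> x /\<^sub>R s \<in> K} s \<partial>lborel \<partial>lborel)"
    unfolding exp_gauge_def
    using lborel_pair.Fubini'[OF borel_measurable_exp_gauge_integrand[OF assms]] by simp
  also have "\<dots> = (\<integral>\<^sup>+s. ennreal (s ^ DIM('a) * exp (- s)) * indicator {0..} s * emeasure lborel K \<partial>lborel)"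
  proof (rule nn_integral_cong)
    fix s :: real
    show "(\<integral>\<^sup>+x. ennreal (exp (- s)) * indicator {s. 0 < s \<and> x /\<^sub>R s \<in> K} s \<partial>lborel)
      = ennreal (s ^ DIM('a) * exp (- s)) * indicator {0..} s * emeasure lborel K"
    proof (cases "0 < s")
      case True
      have eq: "(\<lambda>y. s *\<^sub>R y) ` K = {x. x /\<^sub>R s \<in> K}"
        using True by (force simp: image_iff)
      have "compact ((\<lambda>y. s *\<^sub>R y) ` K)" using assms by (rule compact_scaling)
      then have sets: "(\<lambda>y. s *\<^sub>R y) ` K \<in> sets borel" by (rule borel_compact)
      have "(\<integral>\<^sup>+x. ennreal (exp (- s)) * indicator {s. 0 < s \<and> x /\<^sub>R s \<in> K} s \<partial>lborel)
        = (\<integral>\<^sup>+x. ennreal (exp (- s)) * indicator ((\<lambda>y. s *\<^sub>R y) ` K) x \<partial>lborel)"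
        using True unfolding eq by (intro nn_integral_cong) (auto split: split_indicator)
      also have "\<dots> = ennreal (exp (- s)) * emeasure lborel ((\<lambda>y. s *\<^sub>R y) ` K)"
        using sets by (simp add: nn_integral_cmult_indicator)
      also have "emeasure lborel ((\<lambda>y. s *\<^sub>R y) ` K) = ennreal (s ^ DIM('a)) * emeasure lborel K"
        using emeasure_lebesgue_affine[of s 0 K] True sets K
        by (simp add: ennreal_power)
      finally show ?thesis
        using True by (simp add: ennreal_mult' mult_ac)
    next
      \<comment> \<open>At \<open>s = 0\<close> both sides vanish, since the dimension is
        positive.\<close>
      case False
      then show ?thesis by (auto split: split_indicator)
    qed
  qed
  also have "\<dots> = (\<integral>\<^sup>+s. ennreal (s ^ DIM('a) * exp (- s)) * indicator {0..} s \<partial>lborel) * emeasure lborel K"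
    by (rule nn_integral_multc) simp
  also have "\<dots> = fact DIM('a) * emeasure lborel K"
    by (simp add: nn_intergal_power_times_exp_Ici ennreal_fact)
  finally show ?thesis .
qed

section \<open>Translation invariance and the pointwise inequality\<close>

lemma nn_integral_lborel_shift:
  fixes f :: "'a::euclidean_space \<Rightarrow> ennreal"
  assumes "f \<in> borel_measurable borel"
  shows "(\<integral>\<^sup>+x. f (a + x) \<partial>lborel) = (\<integral>\<^sup>+x. f x \<partial>lborel)"
proof -
  have "(\<integral>\<^sup>+x. f x \<partial>lborel) = (\<integral>\<^sup>+x. f x \<partial>distr lborel borel ((+) a))"
    by (simp add: lborel_distr_plus)
  also have "\<dots> = (\<integral>\<^sup>+x. f (a + x) \<partial>lborel)"
    using assms by (subst nn_integral_distr) auto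
  finally show ?thesis by simp
qed

text \<open>The order of quantifiers is the point: \<open>a\<close> depends on \<open>z\<close>
  alone, so the bound can be integrated over \<open>w\<close> with a fixed shift.\<close>

lemma exp_gauge_product_ge:
  assumes K: "compact K" "convex K" "0 \<in> K" and L: "compact L" "convex L" "0 \<in> L"
    and \<theta>: "0 \<le> \<theta>" "\<theta> \<le> 1"
  obtains a where "\<And>w. exp_gauge (convex hull (L \<union> uminus ` K)) z *
      exp_gauge ((\<lambda>x. \<theta> *\<^sub>R x) ` K \<inter> (\<lambda>x. (1 - \<theta>) *\<^sub>R x) ` L) w
    \<le> exp_gauge K (a + w) * exp_gauge L (z + (a + w))"
proof (cases "exp_gauge (convex hull (L \<union> uminus ` K)) z = 0")
  case True
  then show ?thesis by (intro that[of 0]) simp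
next
  case False
  let ?M = "(\<lambda>x. \<theta> *\<^sub>R x) ` K \<inter> (\<lambda>x. (1 - \<theta>) *\<^sub>R x) ` L"
  \<comment> \<open>The triangle inequality for gauges, as an inclusion of \<open>p C + q C\<close>
    in \<open>(p + q) C\<close>.\<close>
  have scaled_sum: "p *\<^sub>R u + q *\<^sub>R v \<in> (\<lambda>y. (p + q) *\<^sub>R y) ` C"
    if "convex C" "u \<in> C" "v \<in> C" "0 \<le> p" "0 \<le> q" for p q :: real and u v :: 'a and C
  proof (cases "p + q = 0")
    case True
    then have "p = 0" "q = 0" using that by auto
    then show ?thesis using that by auto
  next
    case False
    have "(p / (p + q)) *\<^sub>R u + (q / (p + q)) *\<^sub>R v \<in> C"
      using that False by (intro convexD) (auto simp flip: add_divide_distrib)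
    moreover have "p *\<^sub>R u + q *\<^sub>R v = (p + q) *\<^sub>R ((p / (p + q)) *\<^sub>R u + (q / (p + q)) *\<^sub>R v)"
      using False by (simp add: scaleR_add_right)
    ultimately show ?thesis by blast
  qed
  have "compact (uminus ` K)" using K(1) by (rule compact_negations)
  then have "compact (convex hull (L \<union> uminus ` K))"
    using L by (intro compact_convex_hull compact_Un)
  then obtain r where r: "0 \<le> r" "z \<in> (\<lambda>y. r *\<^sub>R y) ` (convex hull (L \<union> uminus ` K))"
      "exp_gauge (convex hull (L \<union> uminus ` K)) z \<le> ennreal (exp (- r))"
    using False by (elim exp_gauge_attained)
  have "convex (uminus ` K)" using K(2) by (rule convex_negations)
  then obtain p q k l where z: "0 \<le> p" "0 \<le> q" "p + q = 1" "k \<in> K" "l \<in> L"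
      "z = r *\<^sub>R (q *\<^sub>R l + p *\<^sub>R (- k))"
  proof -
    obtain d where d: "d \<in> convex hull (L \<union> uminus ` K)" "z = r *\<^sub>R d" using r(2) by blast
    have "L \<noteq> {}" "uminus ` K \<noteq> {}" using L K by auto
    then obtain q p l k where "q \<ge> 0" "p \<ge> 0" "q + p = 1" "l \<in> L" "k \<in> K"
        "d = q *\<^sub>R l + p *\<^sub>R (- k)"
      using d(1) convex_hull_union_two[OF L(2) _ \<open>convex (uminus ` K)\<close>] by blast
    then show thesis using d(2) by (intro that[of p q k l]) auto
  qed
  \<comment> \<open>As \<open>z = r q l - r p k\<close>, the shift \<open>a = r p k\<close> lies in
    \<open>(r p) K\<close> and cancels the \<open>K\<close> part, leaving \<open>z + a\<close> in
    \<open>(r q) L\<close>.\<close>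
  show ?thesis
  proof (rule that[of "(r * p) *\<^sub>R k"])
    fix w
    show "exp_gauge (convex hull (L \<union> uminus ` K)) z * exp_gauge ?M w
      \<le> exp_gauge K ((r * p) *\<^sub>R k + w) * exp_gauge L (z + ((r * p) *\<^sub>R k + w))"
    proof (cases "exp_gauge ?M w = 0")
      case True
      then show ?thesis by simp
    next
      case False
      have "compact ?M" using K L by (intro compact_Int compact_scaling)
      then obtain t where t: "0 \<le> t" "w \<in> (\<lambda>y. t *\<^sub>R y) ` ?M"
          "exp_gauge ?M w \<le> ennreal (exp (- t))"
        using False by (elim exp_gauge_attained)
      \<comment> \<open>A point of \<open>t M\<close> lies in both \<open>(t \<theta>) K\<close> and
        \<open>(t (1 - \<theta>)) L\<close>, so the scale \<open>t\<close> is shared between the two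
        bodies.\<close>
      obtain u v where u: "u \<in> K" "w = (t * \<theta>) *\<^sub>R u"
          and v: "v \<in> L" "w = (t * (1 - \<theta>)) *\<^sub>R v"
      proof -
        obtain m where m: "m \<in> ?M" "w = t *\<^sub>R m" using t(2) by blast
        obtain u v where "u \<in> K" "m = \<theta> *\<^sub>R u" "v \<in> L" "m = (1 - \<theta>) *\<^sub>R v"
          using m(1) by blast
        then show thesis using m(2) by (intro that[of u v]) (metis scaleR_scaleR)+
      qed
      have "(r * p) *\<^sub>R k + w \<in> (\<lambda>y. (r * p + t * \<theta>) *\<^sub>R y) ` K"
        unfolding u(2) using K u z r t \<theta> by (intro scaled_sum) auto
      then have gK: "ennreal (exp (- (r * p + t * \<theta>))) \<le> exp_gauge K ((r * p) *\<^sub>R k + w)"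
        using K z r t \<theta> by (intro exp_gauge_ge) auto
      have "z + ((r * p) *\<^sub>R k + w) = (r * q) *\<^sub>R l + (t * (1 - \<theta>)) *\<^sub>R v"
        unfolding z(6) v(2)[symmetric] by (simp add: algebra_simps)
      also have "\<dots> \<in> (\<lambda>y. (r * q + t * (1 - \<theta>)) *\<^sub>R y) ` L"
        using L v z r t \<theta> by (intro scaled_sum) auto
      finally have gL: "ennreal (exp (- (r * q + t * (1 - \<theta>))))
          \<le> exp_gauge L (z + ((r * p) *\<^sub>R k + w))"
        using L z r t \<theta> by (intro exp_gauge_ge) auto
      have split: "r + t = (r * p + t * \<theta>) + (r * q + t * (1 - \<theta>))"
      proof -
        have "r = r * (p + q)" using z(3) by simp
        then show ?thesis by (simp add: algebra_simps)
      qed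
      have "exp_gauge (convex hull (L \<union> uminus ` K)) z * exp_gauge ?M w
          \<le> ennreal (exp (- r)) * ennreal (exp (- t))"
        using r(3) t(3) by (rule mult_mono) auto
      also have "\<dots> = ennreal (exp (- (r + t)))"
        by (simp flip: ennreal_mult' exp_add)
      also have "\<dots> = ennreal (exp (- (r * p + t * \<theta>))) * ennreal (exp (- (r * q + t * (1 - \<theta>))))"
        unfolding split by (simp flip: ennreal_mult' exp_add)
      also have "\<dots> \<le> exp_gauge K ((r * p) *\<^sub>R k + w) * exp_gauge L (z + ((r * p) *\<^sub>R k + w))"
        using gK gL by (rule mult_mono) auto
      finally show ?thesis .
    qed
  qed
qed

section \<open>Integration over the fibers and comparison of volumes\<close>

theorem theorem1p6:
  fixes K L :: "'a::euclidean_space set" and \<theta> :: real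
  assumes "convex_body K" and "convex_body L" and "0 \<in> K \<inter> L"
    and "0 \<le> \<theta>" and "\<theta> \<le> 1"
  shows "measure lebesgue (convex hull (L \<union> uminus ` K)) *
           measure lebesgue ((\<lambda>x. \<theta> *\<^sub>R x) ` K \<inter> (\<lambda>x. (1 - \<theta>) *\<^sub>R x) ` L)
         \<le> measure lebesgue K * measure lebesgue L"
proof -
  have K: "compact K" "convex K" "0 \<in> K" and L: "compact L" "convex L" "0 \<in> L"
    using assms by (auto simp: convex_body_def)
  let ?D = "convex hull (L \<union> uminus ` K)"
  let ?M = "(\<lambda>x. \<theta> *\<^sub>R x) ` K \<inter> (\<lambda>x. (1 - \<theta>) *\<^sub>R x) ` L"
  let ?F = "fact DIM('a) :: ennreal"
  have "compact (uminus ` K)" using K(1) by (rule compact_negations)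
  then have D: "compact ?D" using L by (intro compact_convex_hull compact_Un)
  have M: "compact ?M" using K L by (intro compact_Int compact_scaling)
  have [measurable]: "exp_gauge K \<in> borel_measurable borel" "exp_gauge L \<in> borel_measurable borel"
      "exp_gauge ?D \<in> borel_measurable borel" "exp_gauge ?M \<in> borel_measurable borel"
    using borel_measurable_exp_gauge K L D M by auto
  have fiber: "exp_gauge ?D z * (\<integral>\<^sup>+w. exp_gauge ?M w \<partial>lborel)
      \<le> (\<integral>\<^sup>+x. exp_gauge K x * exp_gauge L (z + x) \<partial>lborel)" for z
  proof -
    obtain a where a: "\<And>w. exp_gauge ?D z * exp_gauge ?M w
        \<le> exp_gauge K (a + w) * exp_gauge L (z + (a + w))"
      using exp_gauge_product_ge[OF K L assms(4,5)] by blast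
    have "exp_gauge ?D z * (\<integral>\<^sup>+w. exp_gauge ?M w \<partial>lborel)
        = (\<integral>\<^sup>+w. exp_gauge ?D z * exp_gauge ?M w \<partial>lborel)"
      by (rule nn_integral_cmult[symmetric]) simp
    also have "\<dots> \<le> (\<integral>\<^sup>+w. exp_gauge K (a + w) * exp_gauge L (z + (a + w)) \<partial>lborel)"
      using a by (intro nn_integral_mono)
    \<comment> \<open>Translation invariance removes \<open>a\<close>, so its dependence on
      \<open>z\<close> raises no measurability question.\<close>
    also have "\<dots> = (\<integral>\<^sup>+x. exp_gauge K x * exp_gauge L (z + x) \<partial>lborel)"
      by (rule nn_integral_lborel_shift) measurable
    finally show ?thesis .
  qed
  have "(?F * emeasure lborel ?D) * (?F * emeasure lborel ?M)
      = (\<integral>\<^sup>+z. exp_gauge ?D z * (\<integral>\<^sup>+w. exp_gauge ?M w \<partial>lborel) \<partial>lborel)"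
    using D M by (simp add: nn_integral_multc nn_integral_exp_gauge)
  also have "\<dots> \<le> (\<integral>\<^sup>+z. \<integral>\<^sup>+x. exp_gauge K x * exp_gauge L (z + x) \<partial>lborel \<partial>lborel)"
    using fiber by (intro nn_integral_mono)
  \<comment> \<open>With \<open>x\<close> outermost, the inner integral over \<open>z\<close> is a
    translate by \<open>x\<close> and decouples from it.\<close>
  also have "\<dots> = (\<integral>\<^sup>+x. \<integral>\<^sup>+z. exp_gauge K x * exp_gauge L (x + z) \<partial>lborel \<partial>lborel)"
    by (subst lborel_pair.Fubini') (auto simp: add.commute)
  also have "\<dots> = (\<integral>\<^sup>+x. exp_gauge K x * (\<integral>\<^sup>+z. exp_gauge L z \<partial>lborel) \<partial>lborel)"
    by (simp add: nn_integral_cmult nn_integral_lborel_shift)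
  also have "\<dots> = (?F * emeasure lborel K) * (?F * emeasure lborel L)"
    using K L by (simp add: nn_integral_multc nn_integral_exp_gauge)
  finally have le: "(?F * emeasure lborel ?D) * (?F * emeasure lborel ?M)
      \<le> (?F * emeasure lborel K) * (?F * emeasure lborel L)" .
  \<comment> \<open>Compact sets have finite volume, so the extended inequality passes to the reals,
    where the positive factor \<open>(n!)^2\<close> cancels.\<close>
  have em: "emeasure lborel C = ennreal (measure lebesgue C)" if "compact C" for C :: "'a set"
    using emeasure_compact_finite[OF that] that
    by (simp add: emeasure_eq_ennreal_measure borel_compact measure_completion)
  have "fact DIM('a) * measure lebesgue ?D * (fact DIM('a) * measure lebesgue ?M)
      \<le> fact DIM('a) * measure lebesgue K * (fact DIM('a) * measure lebesgue L)"
    using le D M K L by (simp add: em flip: ennreal_mult' ennreal_fact)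
  then show ?thesis by (simp add: mult_ac)
qed

end
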